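(* Let $(U,\Lambda,D,V)$ be an analytic problem with an MRD discretization of $V$, let $U_M\subseteq U$ be a finite-dimensional subspace, and let $(R_N,V_N)$ be an admissible restriction with $$\|u_M\|_D\le 2\,\|R_ND(u_M)\|_{V_N}\quad\text{for all }u_M\in U_M .$$ Let $u^*\in U$, let $C_A\ge 1$, let $u_M^*\in U_M$ be any comparison trial object, and let $\tilde u_M\in U_M$ satisfy $$\|R_ND(u^*-\tilde u_M)\|_{V_N}\le C_A\,\|R_ND(u^*-u_M^* )\|_{V_N}.$$ Then $$\|\tilde u_M-u^*\|_D\le (2C_A+3)\,\|u_M^*-u^*\|_D .$$
   Context: Analytic problem: a real normed linear space $U$ (objects), a set $\Lambda$ of linear functionals on $U$, the data map $D:U\to\mathbb{R}^\Lambda$, $D(u)=\{\lambda(u)\}_{\lambda\in\Lambda}$, and a normed data space $V\subseteq\mathbb{R}^\Lambda$ containing $D(U)$ whose norm satisfies $\|Du\|_V=\sup_{\lambda\in\Lambda}|\lambda(u)|<\infty$ for all $u\in U$. Put $\|u\|_D:=\|Du\|_V$ (a seminorm on $U$). MRD (monotone refinable dense) discretization of a normed data space $V$: a (nonempty) set of pairs $(R_N,V_N)$, called admissible restrictions, together with a relation $\preceq$ (refinement) on them, such that (1) each $V_N$ is a finite-dimensional real normed space with norm $\|\cdot\|_{V_N}$; (2) each $R_N:V\to V_N$ is linear; (3) (monotonicity) $(R_M,V_M)\preceq(R_N,V_N)$ implies $\|R_Mv\|_{V_M}\le\|R_Nv\|_{V_N}$ for all $v\in V$; (4) (refinement) for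 any two admissible restrictions $(R_M,V_M)$, $(R_N,V_N)$ there is an admissible restriction $(R_P,V_P)$ with $(R_M,V_M)\preceq(R_P,V_P)$ and $(R_N,V_N)\preceq(R_P,V_P)$; (5) (density) $\|v\|_V=\sup\|R_Nv\|_{V_N}$ for all $v\in V$, the supremum being over all admissible restrictions. *)

theory Defs
  imports
    Complex_Main
    "HOL-Library.Function_Algebras"
    "HOL-Library.Extended_Nonnegative_Real"
begin

text \<open>Pointwise scalar multiplication, completing the pointwise addition of the library
  to a real vector space structure on function types.\<close>

instantiation "fun" :: (type, real_vector) real_vector
begin

definition scaleR_fun :: "real \<Rightarrow> ('a \<Rightarrow> 'b) \<Rightarrow> 'a \<Rightarrow> 'b"
  where "scaleR_fun c f = (\<lambda>x. c *\<^sub>R f x)"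

instance
  by standard (simp_all add: scaleR_fun_def fun_eq_iff algebra_simps)

end

text \<open>Normed spaces whose dimension may vary within one statement: a linear subspace of an
  ambient real vector space together with a norm, of which only the values on the subspace matter.\<close>

record 'a nspace =
  points :: "'a set"
  nrm :: "'a \<Rightarrow> real"

definition normed_space :: "'a::real_vector nspace \<Rightarrow> bool" where
  "normed_space W \<longleftrightarrow>
     subspace (points W) \<and>
     (\<forall>x\<in>points W. 0 \<le> nrm W x) \<and>
     (\<forall>x\<in>points W. nrm W x = 0 \<longleftrightarrow> x = 0) \<and>
     (\<forall>c. \<forall>x\<in>points W. nrm W (c *\<^sub>R x) = \<bar>c\<bar> * nrm W x) \<and>
     (\<forall>x\<in>points W. \<forall>y\<in>points W. nrm W (x + y) \<le> nrm W x + nrm W y)"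

definition finite_dim_subspace :: "'a::real_vector set \<Rightarrow> bool" where
  "finite_dim_subspace S \<longleftrightarrow> subspace S \<and> (\<exists>B. finite B \<and> span B = S)"

definition linear_map_on ::
    "'a::real_vector set \<Rightarrow> 'b::real_vector set \<Rightarrow> ('a \<Rightarrow> 'b) \<Rightarrow> bool" where
  "linear_map_on S T f \<longleftrightarrow>
     f ` S \<subseteq> T \<and>
     (\<forall>x\<in>S. \<forall>y\<in>S. f (x + y) = f x + f y) \<and>
     (\<forall>c. \<forall>x\<in>S. f (c *\<^sub>R x) = c *\<^sub>R f x)"

text \<open>The space of real families indexed by \<open>\<Lambda>\<close>, represented by functions that vanish
  off \<open>\<Lambda>\<close>.\<close>

definition families :: "'i set \<Rightarrow> ('i \<Rightarrow> real) set" where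
  "families \<Lambda> = {v. \<forall>i. i \<notin> \<Lambda> \<longrightarrow> v i = 0}"

definition data_map :: "('u \<Rightarrow> real) set \<Rightarrow> 'u \<Rightarrow> ('u \<Rightarrow> real) \<Rightarrow> real" where
  "data_map \<Lambda> u = (\<lambda>l. if l \<in> \<Lambda> then l u else 0)"

text \<open>Suprema of nonnegative reals are taken in \<^typ>\<open>ennreal\<close>: equality with the
  \<open>ennreal\<close> image of a norm value includes finiteness, and the supremum of the empty set is 0.\<close>

definition analytic_problem ::
    "('u::real_normed_vector \<Rightarrow> real) set \<Rightarrow> (('u \<Rightarrow> real) \<Rightarrow> real) nspace \<Rightarrow> bool" where
  "analytic_problem \<Lambda> V \<longleftrightarrow>
     (\<forall>l\<in>\<Lambda>. linear l) \<and>
     normed_space V \<and>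
     points V \<subseteq> families \<Lambda> \<and>
     range (data_map \<Lambda>) \<subseteq> points V \<and>
     (\<forall>u. ennreal (nrm V (data_map \<Lambda> u)) = (SUP l\<in>\<Lambda>. ennreal \<bar>l u\<bar>))"

definition data_norm ::
    "('u \<Rightarrow> real) set \<Rightarrow> (('u \<Rightarrow> real) \<Rightarrow> real) nspace \<Rightarrow> 'u \<Rightarrow> real" where
  "data_norm \<Lambda> V u = nrm V (data_map \<Lambda> u)"

text \<open>An admissible restriction is a pair of a map, relevant only on \<open>points V\<close>, and a normed
  space. All the target spaces lie in one ambient vector space \<open>'w\<close>; this loses no generality, as
  \<open>'w\<close> is arbitrary and may be taken to be the direct sum of the target spaces.\<close>

definition MRD_discretization ::
    "'v::real_vector nspace \<Rightarrow> (('v \<Rightarrow> 'w::real_vector) \<times> 'w nspace) set \<Rightarrow>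
     (('v \<Rightarrow> 'w) \<times> 'w nspace \<Rightarrow> ('v \<Rightarrow> 'w) \<times> 'w nspace \<Rightarrow> bool) \<Rightarrow> bool" where
  "MRD_discretization V Adm prec \<longleftrightarrow>
     Adm \<noteq> {} \<and>
     (\<forall>(R, W)\<in>Adm. normed_space W \<and> finite_dim_subspace (points W)) \<and>
     (\<forall>(R, W)\<in>Adm. linear_map_on (points V) (points W) R) \<and>
     (\<forall>(R, W)\<in>Adm. \<forall>(R', W')\<in>Adm. prec (R, W) (R', W') \<longrightarrow>
        (\<forall>v\<in>points V. nrm W (R v) \<le> nrm W' (R' v))) \<and>
     (\<forall>r\<in>Adm. \<forall>s\<in>Adm. \<exists>p\<in>Adm. prec r p \<and> prec s p) \<and>
     (\<forall>v\<in>points V. ennreal (nrm V v) = (SUP (R, W)\<in>Adm. ennreal (nrm W (R v))))"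

end

theory Submission imports Defs begin

text \<open>The argument is a quasi-optimality estimate in the style of Cea's lemma, for two seminorms
  on the space of objects: \<open>p u = \<parallel>Du\<parallel>\<^sub>V\<close> and the computable \<open>q u = \<parallel>R\<^sub>N Du\<parallel>\<close>. Both are pullbacks of
  norms along linear maps, and density of the discretization makes \<open>q\<close> a lower bound for \<open>p\<close>.
  On the trial space the stability hypothesis reverses this bound up to the factor 2. The
  difference between the computed object \<open>u~\<close> and the comparison object \<open>w\<close> is again a trial
  object, so its \<open>p\<close>-norm is controlled by its \<open>q\<close>-norm. The latter is at most
  \<open>q (u~ - u*) + q (u* - w)\<close>, which the near-minimality of \<open>u~\<close> bounds by \<open>(C + 1) q (u* - w)\<close>,
  and hence by \<open>(C + 1) p (w - u*)\<close>. Altogether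
  \<open>p (u~ - u*) \<le> p (u~ - w) + p (w - u*) \<le> 2 q (u~ - w) + p (w - u*) \<le> (2 (C + 1) + 1) p (w - u*)\<close>.\<close>

text \<open>Taking a general linear map \<open>f\<close> lets one pair of lemmas serve both seminorms: \<open>f\<close> is the
  data map for \<open>p\<close> and the restricted data map for \<open>q\<close>.\<close>

lemma pullback_norm_triangle:
  assumes "normed_space W" and f: "linear_map_on UNIV (points W) f"
  shows "nrm W (f (x - z)) \<le> nrm W (f (x - y)) + nrm W (f (y - z))"
proof -
  have "f (x - z) = f (x - y) + f (y - z)"
    using f unfolding linear_map_on_def by (metis UNIV_I diff_add_cancel add_diff_eq)
  moreover have "f (x - y) \<in> points W" "f (y - z) \<in> points W"
    using f by (auto simp: linear_map_on_def)
  ultimately show ?thesis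
    using assms(1) by (simp add: normed_space_def)
qed

lemma pullback_norm_commute:
  assumes "normed_space W" and f: "linear_map_on UNIV (points W) f"
  shows "nrm W (f (x - y)) = nrm W (f (y - x))"
proof -
  have "f (x - y) = (-1) *\<^sub>R f (y - x)"
    using f unfolding linear_map_on_def by (metis UNIV_I minus_diff_eq scaleR_minus1_left)
  moreover have "f (y - x) \<in> points W"
    using f by (auto simp: linear_map_on_def)
  moreover have "\<forall>c. \<forall>v\<in>points W. nrm W (c *\<^sub>R v) = \<bar>c\<bar> * nrm W v"
    using assms(1) unfolding normed_space_def by blast
  ultimately show ?thesis
    by (metis abs_minus abs_one mult_1)
qed

lemma linear_map_on_compose:
  assumes "linear_map_on S T f" and "linear_map_on T T' g"
  shows "linear_map_on S T' (\<lambda>x. g (f x))"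
  using assms by (auto simp: linear_map_on_def image_subset_iff)

lemma linear_map_on_data_map:
  assumes "analytic_problem \<Lambda> V"
  shows "linear_map_on UNIV (points V) (data_map \<Lambda>)"
  using assms
  by (auto simp: analytic_problem_def linear_map_on_def data_map_def scaleR_fun_def fun_eq_iff
      linear_add linear_scale)

text \<open>By density the data norm is the supremum of the discrete norms, so it dominates each one.\<close>

lemma restriction_norm_le:
  assumes "MRD_discretization V Adm prec" and "normed_space V"
    and "(R, W) \<in> Adm" and "v \<in> points V"
  shows "nrm W (R v) \<le> nrm V v"
proof -
  have "ennreal (nrm W (R v)) \<le> (SUP (R, W)\<in>Adm. ennreal (nrm W (R v)))"
    by (rule SUP_upper2[OF assms(3)]) simp
  also have "\<dots> = ennreal (nrm V v)"
    using assms(1,4) by (simp add: MRD_discretization_def)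
  finally show ?thesis
    using assms(2,4) by (simp add: normed_space_def ennreal_le_iff)
qed

theorem theorem7p2:
  fixes \<Lambda> :: "('u::real_normed_vector \<Rightarrow> real) set"
    and V :: "(('u \<Rightarrow> real) \<Rightarrow> real) nspace"
    and Adm :: "(((('u \<Rightarrow> real) \<Rightarrow> real) \<Rightarrow> 'w::real_vector) \<times> 'w nspace) set"
    and prec :: "((('u \<Rightarrow> real) \<Rightarrow> real) \<Rightarrow> 'w) \<times> 'w nspace \<Rightarrow>
                    ((('u \<Rightarrow> real) \<Rightarrow> real) \<Rightarrow> 'w) \<times> 'w nspace \<Rightarrow> bool"
    and U\<^sub>M :: "'u set"
    and R\<^sub>N :: "(('u \<Rightarrow> real) \<Rightarrow> real) \<Rightarrow> 'w" and V\<^sub>N :: "'w nspace"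
    and u_star u_M_star u_tilde :: 'u
    and C\<^sub>A :: real
  assumes "analytic_problem \<Lambda> V"
    and "MRD_discretization V Adm prec"
    and "finite_dim_subspace U\<^sub>M"
    and "(R\<^sub>N, V\<^sub>N) \<in> Adm"
    and "\<And>u. u \<in> U\<^sub>M \<Longrightarrow> data_norm \<Lambda> V u \<le> 2 * nrm V\<^sub>N (R\<^sub>N (data_map \<Lambda> u))"
    and "C\<^sub>A \<ge> 1"
    and "u_M_star \<in> U\<^sub>M"
    and "u_tilde \<in> U\<^sub>M"
    and "nrm V\<^sub>N (R\<^sub>N (data_map \<Lambda> (u_star - u_tilde)))
           \<le> C\<^sub>A * nrm V\<^sub>N (R\<^sub>N (data_map \<Lambda> (u_star - u_M_star)))"
  shows "data_norm \<Lambda> V (u_tilde - u_star) \<le> (2 * C\<^sub>A + 3) * data_norm \<Lambda> V (u_M_star - u_star)"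
proof -
  define p where "p u = nrm V (data_map \<Lambda> u)" for u
  define q where "q u = nrm V\<^sub>N (R\<^sub>N (data_map \<Lambda> u))" for u
  have V: "normed_space V"
    using assms(1) by (simp add: analytic_problem_def)
  have D: "linear_map_on UNIV (points V) (data_map \<Lambda>)"
    using assms(1) by (rule linear_map_on_data_map)
  have V\<^sub>N: "normed_space V\<^sub>N" and "linear_map_on (points V) (points V\<^sub>N) R\<^sub>N"
    using assms(2,4) by (auto simp: MRD_discretization_def)
  then have RD: "linear_map_on UNIV (points V\<^sub>N) (\<lambda>u. R\<^sub>N (data_map \<Lambda> u))"
    using D linear_map_on_compose by blast
  have "u_tilde - u_M_star \<in> U\<^sub>M"
    using assms(3,7,8) by (simp add: finite_dim_subspace_def subspace_diff)
  then have stable: "p (u_tilde - u_M_star) \<le> 2 * q (u_tilde - u_M_star)"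
    using assms(5) by (simp add: p_def q_def data_norm_def)
  have "q (u_tilde - u_M_star) \<le> q (u_tilde - u_star) + q (u_star - u_M_star)"
    unfolding q_def by (rule pullback_norm_triangle[OF V\<^sub>N RD])
  also have "q (u_tilde - u_star) = q (u_star - u_tilde)"
    unfolding q_def by (rule pullback_norm_commute[OF V\<^sub>N RD])
  also have "\<dots> \<le> C\<^sub>A * q (u_star - u_M_star)"
    using assms(9) by (simp add: q_def)
  finally have "q (u_tilde - u_M_star) \<le> (C\<^sub>A + 1) * q (u_star - u_M_star)"
    by (simp add: algebra_simps)
  also have "\<dots> \<le> (C\<^sub>A + 1) * p (u_star - u_M_star)"
  proof (rule mult_left_mono)
    have "data_map \<Lambda> (u_star - u_M_star) \<in> points V"
      using D by (auto simp: linear_map_on_def)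
    then show "q (u_star - u_M_star) \<le> p (u_star - u_M_star)"
      unfolding p_def q_def by (rule restriction_norm_le[OF assms(2) V assms(4)])
  qed (use assms(6) in simp)
  also have "p (u_star - u_M_star) = p (u_M_star - u_star)"
    unfolding p_def by (rule pullback_norm_commute[OF V D])
  finally have "q (u_tilde - u_M_star) \<le> (C\<^sub>A + 1) * p (u_M_star - u_star)" .
  moreover have "p (u_tilde - u_star) \<le> p (u_tilde - u_M_star) + p (u_M_star - u_star)"
    unfolding p_def by (rule pullback_norm_triangle[OF V D])
  ultimately have "p (u_tilde - u_star) \<le> (2 * C\<^sub>A + 3) * p (u_M_star - u_star)"
    using stable by (simp add: algebra_simps)
  then show ?thesis
    by (simp add: p_def data_norm_def)
qed

end
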